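(* For every integer $r\ge 3$ there exists a positive real $t_r$ such that for every $t\in(0,t_r)$, \[\delta(r,t)=\frac{1}{r}+\left(1-\frac{1}{r}\right)t.\]
   Context: An edge weighting of the complete graph $K_n$ is a function $w\colon E(K_n)\to[0,1]$. The weighted degree $\deg_w(v)$ of a vertex $v$ is the sum of the weights of the edges incident to $v$, and $\delta_w(K_n)=\min_v \deg_w(v)$. A $K_r$-factor of $K_n$ is a collection of $n/r$ vertex-disjoint copies of $K_r$ covering all vertices; the weight of a copy of $K_r$ is the sum of the weights of its $\binom{r}{2}$ edges. For $n\in r\mathbb{Z}$, let $\mathcal{W}(r,t,n)$ be the set of edge weightings of $K_n$ such that every $K_r$-factor contains a clique of weight strictly smaller than $t\binom{r}{2}$. Define $\delta(r,t,n)=\sup_{w\in\mathcal{W}(r,t,n)}\delta_w(K_n)$ and $\delta(r,t)=\limsup_{n\to\infty}\delta(r,t,n)/n$ (over $n$ divisible by $r$). *)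

theory Defs
  imports "HOL-Analysis.Analysis" "HOL-Library.Ramsey"
begin

text \<open>The complete graph on \<open>n\<close> vertices has vertex set \<open>{..<n}\<close>. The edges of the complete graph
  on a vertex set \<open>S\<close> are its two-element subsets, \<open>nsets S 2\<close>.\<close>

type_synonym weighting = "nat set \<Rightarrow> real"

text \<open>Weightings are extensional, so that two of them are equal iff they agree on all edges.\<close>

definition edge_weightings :: "nat \<Rightarrow> weighting set" where
  "edge_weightings n = nsets {..<n} 2 \<rightarrow>\<^sub>E {0..1}"

definition weighted_degree :: "nat \<Rightarrow> weighting \<Rightarrow> nat \<Rightarrow> real" where
  "weighted_degree n w v = (\<Sum>e\<in>{e \<in> nsets {..<n} 2. v \<in> e}. w e)"

definition min_weighted_degree :: "nat \<Rightarrow> weighting \<Rightarrow> real" where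
  "min_weighted_degree n w = Min (weighted_degree n w ` {..<n})"

text \<open>A copy of \<open>K\<^sub>r\<close> in a complete graph is determined by its set of \<open>r\<close> vertices, so a factor is
  a partition of the vertex set into sets of size \<open>r\<close> (necessarily \<open>n / r\<close> many).\<close>

definition clique_factor :: "nat \<Rightarrow> nat \<Rightarrow> nat set set \<Rightarrow> bool" where
  "clique_factor r n F \<longleftrightarrow> partition_on {..<n} F \<and> (\<forall>C\<in>F. card C = r)"

definition clique_weight :: "weighting \<Rightarrow> nat set \<Rightarrow> real" where
  "clique_weight w C = (\<Sum>e\<in>nsets C 2. w e)"

definition bad_weightings :: "nat \<Rightarrow> real \<Rightarrow> nat \<Rightarrow> weighting set" where
  "bad_weightings r t n =
    {w \<in> edge_weightings n.
       \<forall>F. clique_factor r n F \<longrightarrow> (\<exists>C\<in>F. clique_weight w C < t * real (r choose 2))}"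

text \<open>The supremum is over a set bounded by \<open>n - 1\<close> when \<open>n > 0\<close>; if moreover \<open>t > 0\<close> and \<open>r \<ge> 2\<close>,
  that set is nonempty, as it contains the value at the zero weighting.\<close>

definition degree_threshold_at :: "nat \<Rightarrow> real \<Rightarrow> nat \<Rightarrow> real" where
  "degree_threshold_at r t n = (SUP w\<in>bad_weightings r t n. min_weighted_degree n w)"

text \<open>The filter below is \<open>n \<longlongrightarrow> \<infinity>\<close> along the multiples of \<open>r\<close>.\<close>

definition degree_threshold :: "nat \<Rightarrow> real \<Rightarrow> ereal" where
  "degree_threshold r t =
    Limsup (inf sequentially (principal {n. r dvd n})) (\<lambda>n. ereal (degree_threshold_at r t n / real n))"

end

theory Submission
  imports Defs
begin

text \<open>
  Let \<open>n = r * N\<close> and call an edge heavy if its weight alone is at least \<open>s = t * (r choose 2)\<close>;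
  a clique containing a heavy edge is good. A weighted minimum degree of \<open>N + t * (n - N)\<close> forces
  heavy minimum degree at least \<open>N - D\<close>, where \<open>D = s * n\<close> is a tiny multiple of \<open>N\<close>. If there is
  no heavy matching of size \<open>N\<close>, augmenting paths of length 3 and 5 for a maximum heavy matching show
  that the heavy graph looks like the extremal example: it has a set \<open>A\<close> of about \<open>N\<close> vertices that
  can be matched robustly into the complement \<open>B\<close> by heavy edges, while heavy degrees inside \<open>B\<close> are
  small. If \<open>k = N - card A\<close> is positive, every vertex of \<open>B\<close> still has weighted degree at least
  \<open>k + t * (n - N)\<close> inside \<open>B\<close>. Fewer than \<open>k\<close> disjoint good cliques cannot absorb this excess of
  \<open>k\<close> over density \<open>t\<close>, so \<open>B\<close> contains \<open>k\<close> disjoint good cliques, and they extend, together with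
  the heavy edges at \<open>A\<close>, to a factor. Hence the threshold is at most \<open>N + t * (n - N)\<close>, for
  every \<open>n\<close> divisible by \<open>r\<close>. It is attained up to an additive 1 by giving weight 1 to all edges that
  meet a fixed set of \<open>N - 1\<close> vertices, and weight just below \<open>t\<close> to all others.
\<close>

subsection \<open>Matchings and independent sets\<close>

text \<open>Edges are two-element sets, so a matching is a \<open>disjoint\<close> family, just like
  the families of good cliques it is later combined with. A loop would pass as a singleton;
  \<open>E\<close> is irreflexive wherever sizes of edges are counted.\<close>

definition matching :: "'a set \<Rightarrow> ('a \<Rightarrow> 'a \<Rightarrow> bool) \<Rightarrow> 'a set set \<Rightarrow> bool" where
  "matching V E M \<longleftrightarrow> disjoint M \<and> (\<forall>e\<in>M. \<exists>u\<in>V. \<exists>v\<in>V. E u v \<and> e = {u, v})"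

text \<open>The exchange behind all augmenting paths: the edges kept from \<open>M\<close> avoid the
  vertices of \<open>P\<close> because \<open>M\<close> is disjoint, and they contain no unmatched
  vertex, so they cannot meet \<open>Q\<close>.\<close>

lemma matching_augment:
  assumes M: "matching V E M" and fin: "finite M" and P: "P \<subseteq> M"
    and Q: "matching V E Q" "finite Q" and cover: "\<Union>Q \<subseteq> \<Union>P \<union> (V - \<Union>M)"
  shows "matching V E (M - P \<union> Q)" and "card (M - P \<union> Q) = card M - card P + card Q"
proof -
  have avoid: "e \<inter> f = {}" if "e \<in> M - P" "f \<in> Q" for e f
  proof -
    have "e \<inter> p = {}" if "p \<in> P" for p
      using that \<open>e \<in> M - P\<close> P M disjointD[of M e p] unfolding matching_def by auto
    then have "e \<inter> \<Union>P = {}" by blast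
    then show ?thesis using that cover by blast
  qed
  have "disjoint (M - P \<union> Q)"
    using avoid M Q(1) unfolding matching_def disjoint_def by (metis DiffD1 Int_commute UnE)
  then show "matching V E (M - P \<union> Q)"
    using M Q(1) unfolding matching_def by blast
  have "e \<noteq> {}" if "e \<in> M" for e
    using that M unfolding matching_def by blast
  then have "(M - P) \<inter> Q = {}" using avoid by fastforce
  then show "card (M - P \<union> Q) = card M - card P + card Q"
    using fin P Q(2) by (simp add: card_Un_disjoint card_Diff_subset finite_subset)
qed

lemma sum_card_swap:
  assumes "finite U" "finite W"
  shows "(\<Sum>u\<in>U. card {x\<in>W. E u x}) = (\<Sum>x\<in>W. card {u\<in>U. E u x})"
proof -
  have "(\<Sum>u\<in>U. card {x\<in>W. E u x}) = (\<Sum>u\<in>U. \<Sum>x\<in>W. if E u x then 1 else 0)"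
    using assms(2) by (simp add: sum.If_cases Int_def)
  also have "\<dots> = (\<Sum>x\<in>W. \<Sum>u\<in>U. if E u x then 1 else 0)" by (rule sum.swap)
  also have "\<dots> = (\<Sum>x\<in>W. card {u\<in>U. E u x})"
    using assms(1) by (simp add: sum.If_cases Int_def)
  finally show ?thesis .
qed

lemma ex_other_element:
  assumes "2 \<le> card A" shows "\<exists>a\<in>A. a \<noteq> b"
proof (rule ccontr)
  assume "\<not> ?thesis"
  then have "A \<subseteq> {b}" by blast
  then have "card A \<le> 1" using card_mono[of "{b}" A] by simp
  then show False using assms by simp
qed

text \<open>For a maximum matching \<open>M\<close>, the set consists of the unmatched vertices
  \<open>U\<close> and the partners \<open>Y\<close> of matched vertices with at least two
  neighbours in \<open>U\<close>. An edge inside it would yield an augmenting path of length 1, 3 or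
  5. By the degree bound nearly \<open>N\<close> edges of \<open>M\<close> have an end in
  \<open>Y\<close>, so few vertices remain outside.\<close>

lemma large_independent_set:
  fixes D :: real
  assumes V: "finite V" "card V = r * N" "r \<ge> 3" and D: "D \<ge> 0"
    and sym: "\<And>u v. E u v \<Longrightarrow> E v u" and irr: "\<And>v. \<not> E v v"
    and deg: "\<And>v. v \<in> V \<Longrightarrow> real N - D \<le> card {u\<in>V. E v u}"
    and small: "\<And>M. matching V E M \<Longrightarrow> card M < N"
  obtains I where "I \<subseteq> V" "\<And>u v. u \<in> I \<Longrightarrow> v \<in> I \<Longrightarrow> \<not> E u v" "card (V - I) \<le> N + 3 * D"
proof -
  have "matching V E {}" by (simp add: matching_def disjoint_def)
  moreover have "\<forall>M. matching V E M \<longrightarrow> card M < N" using small by blast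
  ultimately have "\<exists>M. matching V E M \<and> (\<forall>M'. matching V E M' \<longrightarrow> card M' \<le> card M)"
    by (rule ex_has_greatest_nat)
  then obtain M where M: "matching V E M"
    and max: "\<And>M'. matching V E M' \<Longrightarrow> card M' \<le> card M"
    by (elim exE conjE) simp
  have edge: "\<exists>u\<in>V. \<exists>v\<in>V. E u v \<and> u \<noteq> v \<and> e = {u, v}" if "e \<in> M" for e
    using M that irr unfolding matching_def by metis
  have MV: "\<Union>M \<subseteq> V" using edge by blast
  then have finM: "finite M" using V(1) by (meson finite_UnionD finite_subset)
  have card2: "card e = 2" "finite e" if "e \<in> M" for e using edge[OF that] by auto
  have disj: "disjoint M" using M by (simp add: matching_def)
  define U where "U = V - \<Union>M"
  have U: "U \<subseteq> V" "finite U" "\<And>u. u \<in> U \<Longrightarrow> u \<notin> \<Union>M" using V(1) by (auto simp: U_def)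
  have cardUn: "card (\<Union>M) = 2 * card M"
    using card_Union_disjoint[of M] disj card2 by (simp add: disjoint_def pairwise_def disjnt_def)
  have mN: "card M < N" using small M by simp
  \<comment> \<open>\<open>r * N - 2 * card M\<close> is at least \<open>N + 2\<close>. The value 3
    keeps \<open>card U - 2\<close> positive in the final count.\<close>
  have cardU: "card U \<ge> 3"
  proof -
    have "card U = r * N - 2 * card M"
      using V MV cardUn by (simp add: U_def card_Diff_subset finite_subset)
    moreover have "3 * N \<le> r * N" using V(3) by simp
    ultimately show ?thesis using mN by linarith
  qed
  have no_aug: "card Q \<le> card P"
    if "P \<subseteq> M" "matching V E Q" "finite Q" "\<Union>Q \<subseteq> \<Union>P \<union> U" for P Q
  proof -
    have "card M - card P + card Q \<le> card M"
      using matching_augment[OF M finM that(1-3)] that(4) max unfolding U_def by metis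
    then show ?thesis using card_mono[OF finM that(1)] by linarith
  qed
  have UU: "\<not> E u v" if "u \<in> U" "v \<in> U" for u v
  proof
    assume "E u v"
    then have "matching V E {{u, v}}" using that U(1) unfolding matching_def disjoint_def by blast
    from no_aug[OF _ this, of "{}"] show False using that by simp
  qed
  have inM: "x \<in> V" "y \<in> V" "E x y" "x \<noteq> y" "x \<notin> U" "y \<notin> U" if "{x, y} \<in> M" for x y
  proof -
    have "x \<in> \<Union>M" "y \<in> \<Union>M" using that by blast+
    then show "x \<notin> U" "y \<notin> U" using U(3) by blast+
    show "x \<in> V" "y \<in> V" "E x y" "x \<noteq> y"
      using edge[OF that] sym by (auto simp: doubleton_eq_iff)
  qed
  \<comment> \<open>Distinct ends would give the path \<open>u, x, y, u'\<close>, which trades one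
    matching edge for two.\<close>
  have aug3: "u = u'" if "{x, y} \<in> M" "E x u" "E y u'" "u \<in> U" "u' \<in> U" for x y u u'
  proof (rule ccontr)
    assume ne: "u \<noteq> u'"
    have "matching V E {{x, u}, {y, u'}}"
      using that ne inM[OF that(1)] U unfolding matching_def disjoint_def by fastforce
    from no_aug[OF _ this, of "{{x, y}}"] that inM[OF that(1)] ne show False
      by (auto simp: doubleton_eq_iff card_insert_if split: if_splits)
  qed
  \<comment> \<open>The path \<open>u, x, y, y', x', u'\<close> trades two matching edges for
    three.\<close>
  have aug5: False if "{x, y} \<in> M" "{x', y'} \<in> M" "{x, y} \<noteq> {x', y'}" "E y y'"
    "E x u" "E x' u'" "u \<in> U" "u' \<in> U" "u \<noteq> u'" for x y x' y' u u'
  proof -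
    have "{x, y} \<inter> {x', y'} = {}" using disjointD[OF disj that(1-3)] .
    then have d: "x \<noteq> x'" "x \<noteq> y'" "y \<noteq> x'" "y \<noteq> y'" by auto
    note i = inM[OF that(1)] inM[OF that(2)]
    have u: "x \<noteq> u" "x \<noteq> u'" "y \<noteq> u" "y \<noteq> u'" "x' \<noteq> u" "x' \<noteq> u'" "y' \<noteq> u" "y' \<noteq> u'"
      using i that by auto
    have "disjoint {{x, u}, {y, y'}, {x', u'}}"
      using d u i(4,10) that(9) by (simp add: disjoint_def eq_commute)
    moreover have "\<exists>u\<in>V. \<exists>v\<in>V. E u v \<and> e = {u, v}" if "e \<in> {{x, u}, {y, y'}, {x', u'}}" for e
      using that i(1,2,7,8) U(1) \<open>E y y'\<close> \<open>E x u\<close> \<open>E x' u'\<close> \<open>u \<in> U\<close> \<open>u' \<in> U\<close> by blast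
    ultimately have Q: "matching V E {{x, u}, {y, y'}, {x', u'}}" unfolding matching_def by blast
    have "card {{x, u}, {y, y'}, {x', u'}} \<le> card {{x, y}, {x', y'}}"
      using that(1,2,7,8) by (intro no_aug[OF _ Q]) auto
    moreover have "card {{x, y}, {x', y'}} \<le> 2" by (simp add: card_insert_if)
    moreover have "card {{x, u}, {y, y'}, {x', u'}} = 3"
      using d u that(9) by (simp add: card_insert_if doubleton_eq_iff)
    ultimately show False by simp
  qed
  define NU where "NU x = {u\<in>U. E x u}" for x
  have finNU: "finite (NU x)" for x using U by (simp add: NU_def)
  \<comment> \<open>Two neighbours in \<open>U\<close> always leave one that differs from a given
    vertex, and augmenting paths need distinct ends.\<close>
  define X where "X = {x\<in>\<Union>M. card (NU x) \<ge> 2}"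
  define Y where "Y = {y. \<exists>x\<in>X. {x, y} \<in> M}"
  have otherX: "\<exists>u'\<in>U. E x u' \<and> u' \<noteq> u" if "x \<in> X" for x u
    using ex_other_element[of "NU x" u] that by (auto simp: X_def NU_def)
  have YU: "\<not> E y u" if "y \<in> Y" "u \<in> U" for y u
    using that otherX aug3 unfolding Y_def by blast
  have YY: "\<not> E y y'" if y: "y \<in> Y" "y' \<in> Y" for y y'
  proof
    assume E: "E y y'"
    obtain x x' where x: "x \<in> X" "{x, y} \<in> M" "x' \<in> X" "{x', y'} \<in> M"
      using y unfolding Y_def by blast
    obtain u where u: "u \<in> U" "E x u" using otherX x(1) by blast
    obtain u' where u': "u' \<in> U" "E x' u'" "u' \<noteq> u" using otherX x(3) by blast
    show False
    proof (cases "{x, y} = {x', y'}")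
      \<comment> \<open>Both ends of one matching edge lie in \<open>X\<close>, so a path of length
        3 suffices.\<close>
      case True
      then have "x' = y" using E irr by (auto simp: doubleton_eq_iff)
      then show False using aug3[OF x(2) u(2), of u'] u u' by simp
    next
      case False
      then show False using aug5[OF x(2,4) _ E u(2) u'(2)] u u' by blast
    qed
  qed
  \<comment> \<open>An edge of \<open>M1\<close> sends at most \<open>card U\<close> edges to
    \<open>U\<close>, since its end in \<open>Y\<close> sends none. Both ends of an edge of
    \<open>M0\<close> send at most one.\<close>
  define M1 where "M1 = {e\<in>M. e \<inter> X \<noteq> {}}"
  define M0 where "M0 = M - M1"
  have parts: "M1 \<subseteq> M" "M0 \<subseteq> M" "M = M1 \<union> M0" "M1 \<inter> M0 = {}" "finite M1" "finite M0"
    using finM by (auto simp: M1_def M0_def)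
  have M1E: "\<exists>x y. e = {x, y} \<and> x \<in> X \<and> y \<in> Y \<and> x \<noteq> y" if "e \<in> M1" for e
  proof -
    have eM: "e \<in> M" using that parts by blast
    obtain a b where ab: "e = {a, b}" "a \<noteq> b" using edge[OF eM] by blast
    have "a \<in> X \<or> b \<in> X" using that ab by (auto simp: M1_def)
    then show ?thesis
    proof
      assume "a \<in> X" then show ?thesis using ab eM unfolding Y_def by blast
    next
      assume b: "b \<in> X"
      have "{b, a} \<in> M" using ab eM by (simp add: insert_commute)
      then have "a \<in> Y" using b by (auto simp: Y_def)
      moreover have "e = {b, a}" using ab by blast
      ultimately show ?thesis using ab b by blast
    qed
  qed
  have sum1: "(\<Sum>x\<in>e. card (NU x)) \<le> card U" if e: "e \<in> M1" for e
  proof -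
    obtain x y where xy: "e = {x, y}" "x \<in> X" "y \<in> Y" "x \<noteq> y" using M1E[OF e] by blast
    have "NU y = {}" using YU xy by (auto simp: NU_def)
    moreover have "card (NU x) \<le> card U" using U by (auto simp: NU_def intro: card_mono)
    ultimately show ?thesis using xy by simp
  qed
  have sum0: "(\<Sum>x\<in>e. card (NU x)) \<le> 2" if "e \<in> M0" for e
  proof -
    have e: "e \<in> M" "e \<inter> X = {}" using that by (auto simp: M0_def M1_def)
    have "card (NU x) \<le> 1" if "x \<in> e" for x
      using that e by (force simp: X_def)
    then have "(\<Sum>x\<in>e. card (NU x)) \<le> (\<Sum>x\<in>e. 1)" by (intro sum_mono) auto
    then show ?thesis using card2[OF e(1)] by simp
  qed
  have "{v\<in>V. E u v} = {x\<in>\<Union>M. E u x}" if "u \<in> U" for u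
    using UU[OF that] MV unfolding U_def by blast
  then have "(\<Sum>u\<in>U. card {v\<in>V. E u v}) = (\<Sum>u\<in>U. card {x\<in>\<Union>M. E u x})" by simp
  also have "\<dots> = (\<Sum>x\<in>\<Union>M. card {u\<in>U. E u x})"
    using MV V(1) U(2) by (intro sum_card_swap) (auto intro: finite_subset)
  also have "\<dots> = (\<Sum>x\<in>\<Union>M. card (NU x))"
    using sym by (intro sum.cong refl arg_cong[where f = card]) (auto simp: NU_def)
  also have "\<dots> = (\<Sum>e\<in>M. \<Sum>x\<in>e. card (NU x))"
    using disj card2 by (subst sum.Union_disjoint) (auto simp: disjoint_def)
  also have "\<dots> = (\<Sum>e\<in>M1. \<Sum>x\<in>e. card (NU x)) + (\<Sum>e\<in>M0. \<Sum>x\<in>e. card (NU x))"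
    using parts by (metis sum.union_disjoint)
  also have "\<dots> \<le> (\<Sum>e\<in>M1. card U) + (\<Sum>e\<in>M0. 2)"
    using sum1 sum0 by (intro add_mono sum_mono)
  finally have upper: "(\<Sum>u\<in>U. card {v\<in>V. E u v}) \<le> card M1 * card U + 2 * card M0" by simp
  have "(\<Sum>u\<in>U. real N - D) \<le> (\<Sum>u\<in>U. real (card {v\<in>V. E u v}))"
    using deg U(1) by (intro sum_mono) auto
  also have "\<dots> \<le> real (card M1 * card U + 2 * card M0)"
    using upper by (metis of_nat_le_iff of_nat_sum)
  finally have count: "real (card U) * (real N - D) \<le> card M1 * card U + 2 * card M0" by simp
  have m: "card M1 + card M0 < N" using mN parts by (metis card_Un_disjoint)
  \<comment> \<open>The count becomes \<open>p * (card U - 2) \<le> D * card U\<close>, and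
    \<open>card U \<ge> 3\<close> gives \<open>card U \<le> 3 * (card U - 2)\<close>. This is the
    source of the constant in \<open>3 * D\<close>.\<close>
  define p where "p = real N - card M1"
  have p: "real (card M0) \<le> p" using m by (simp add: p_def)
  have "p * card U \<le> D * card U + 2 * p" using count p by (simp add: p_def algebra_simps)
  then have "p * (real (card U) - 2) \<le> D * card U" by (simp add: algebra_simps)
  also have "\<dots> \<le> D * (3 * (real (card U) - 2))"
    using cardU D by (intro mult_left_mono) auto
  finally have "p * (real (card U) - 2) \<le> 3 * D * (real (card U) - 2)" by (simp add: mult_ac)
  then have p3: "p \<le> 3 * D" using cardU by (simp add: mult_le_cancel_right)
  \<comment> \<open>Edges of \<open>M1\<close> leave one vertex outside \<open>Y\<close> and edges
    of \<open>M0\<close> at most two, in total at most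
    \<open>card M1 + 2 * card M0 < N + p\<close>.\<close>
  have "V - (U \<union> Y) \<subseteq> (\<Union>e\<in>M. e - Y)" by (auto simp: U_def)
  then have "card (V - (U \<union> Y)) \<le> card (\<Union>e\<in>M. e - Y)"
    using finM card2 by (intro card_mono) auto
  also have "\<dots> \<le> (\<Sum>e\<in>M. card (e - Y))" using finM by (rule card_UN_le)
  also have "\<dots> = (\<Sum>e\<in>M1. card (e - Y)) + (\<Sum>e\<in>M0. card (e - Y))"
    using parts by (metis sum.union_disjoint)
  also have "\<dots> \<le> (\<Sum>e\<in>M1. 1) + (\<Sum>e\<in>M0. 2)"
  proof (intro add_mono sum_mono)
    fix e assume "e \<in> M1"
    then obtain x y where xy: "e = {x, y}" "x \<in> X" "y \<in> Y" "x \<noteq> y" using M1E by blast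
    then have "e - Y \<subseteq> {x}" by blast
    then show "card (e - Y) \<le> 1" using card_mono[of "{x}" "e - Y"] by simp
  next
    fix e assume "e \<in> M0"
    then have "e \<in> M" using parts by blast
    then show "card (e - Y) \<le> 2" using card2 by (metis Diff_subset card_mono)
  qed
  finally have "real (card (V - (U \<union> Y))) \<le> N + 3 * D" using m p p3 by simp
  moreover have "U \<union> Y \<subseteq> V" using U(1) inM(2) by (auto simp: Y_def)
  moreover have "\<not> E u v" if "u \<in> U \<union> Y" "v \<in> U \<union> Y" for u v
    using that UU YU YY sym by blast
  ultimately show ?thesis using that by blast
qed

subsection \<open>Partitions and injective choices\<close>

text \<open>Induction on the number of sets: one set is enlarged to size \<open>r\<close> while
  avoiding the others. As these occupy at most \<open>r\<close> vertices each, enough room is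
  left.\<close>

lemma disjoint_extends_to_partition:
  assumes "finite V" "card V = r * N" "r > 0" "\<Union>G \<subseteq> V" "disjoint G" "card G = N"
    and "\<And>C. C \<in> G \<Longrightarrow> card C \<le> r"
  shows "\<exists>F. partition_on V F \<and> (\<forall>C\<in>F. card C = r \<and> (\<exists>c\<in>G. c \<subseteq> C))"
  using assms
proof (induction N arbitrary: V G)
  case 0
  then have "V = {}" by simp
  then show ?case by (intro exI[of _ "{}"]) (simp add: partition_on_def)
next
  case (Suc N)
  have finG: "finite G" using Suc.prems(6) card.infinite by fastforce
  obtain c where c: "c \<in> G" using Suc.prems(6) by fastforce
  define G' where "G' = G - {c}"
  have G': "card G' = N" "finite G'" "disjoint G'" using Suc.prems c finG
    by (auto simp: G'_def disjoint_def)
  have cd: "c \<inter> \<Union>G' = {}" using Suc.prems(5) c unfolding G'_def disjoint_def by blast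
  have "card (\<Union>G') \<le> (\<Sum>C\<in>G'. card C)" using G'(2) card_Union_le_sum_card by blast
  also have "\<dots> \<le> (\<Sum>C\<in>G'. r)" using Suc.prems(7) by (intro sum_mono) (simp add: G'_def)
  finally have "card (\<Union>G') \<le> N * r" using G' by simp
  moreover have sub: "\<Union>G' \<subseteq> V" using Suc.prems(4) by (auto simp: G'_def)
  ultimately have "r \<le> card (V - \<Union>G')"
    using Suc.prems(1,2) by (simp add: card_Diff_subset finite_subset mult.commute)
  moreover have "c \<subseteq> V - \<Union>G'" using Suc.prems(4) c cd by blast
  moreover have "card c \<le> r" using Suc.prems(7) c by blast
  ultimately obtain C where C: "c \<subseteq> C" "C \<subseteq> V - \<Union>G'" "card C = r"
    using Suc.prems(1) exists_subset_between[of c r "V - \<Union>G'"] by blast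
  have "C \<subseteq> V" using C by blast
  then have "card (V - C) = r * N"
    using Suc.prems(1,2) C(3) by (simp add: card_Diff_subset finite_subset)
  moreover have "\<Union>G' \<subseteq> V - C" using sub C(2) by blast
  moreover have "card D \<le> r" if "D \<in> G'" for D using that Suc.prems(7) by (simp add: G'_def)
  ultimately obtain F
    where F: "partition_on (V - C) F" "\<forall>C\<in>F. card C = r \<and> (\<exists>c\<in>G'. c \<subseteq> C)"
    using Suc.IH[of "V - C" G'] Suc.prems(1,3) G' by blast
  have "C \<noteq> {}" using C Suc.prems(3) by auto
  moreover have "disjoint (insert C F)"
  proof -
    have "C \<inter> D = {}" if "D \<in> F" for D using F(1) that by (auto simp: partition_on_def)
    then show ?thesis using F(1) by (auto simp: partition_on_def disjoint_def)
  qed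
  ultimately have "partition_on V (insert C F)"
    using F(1) \<open>C \<subseteq> V\<close> unfolding partition_on_def by auto
  then show ?case using F(2) C c by (intro exI[of _ "insert C F"]) (auto simp: G'_def)
qed

text \<open>Greedy choice starting from \<open>f\<close> on \<open>L\<close>: at each new element,
  fewer values are taken than it has candidates.\<close>

lemma extend_injective_choice:
  assumes "finite A" "finite L" "inj_on f L" "\<And>a. a \<in> L \<Longrightarrow> f a \<in> P a"
    and "\<And>a. a \<in> A \<Longrightarrow> a \<notin> L \<Longrightarrow> card (A \<union> L) \<le> card (P a)"
  shows "\<exists>g. inj_on g (A \<union> L) \<and> (\<forall>a\<in>A \<union> L. g a \<in> P a)"
  using assms
proof (induction A rule: finite_induct)
  case empty
  then show ?case by auto
next
  case (insert b A)
  have "card (A \<union> L) \<le> card (insert b A \<union> L)" using insert by (intro card_mono) auto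
  then obtain g where g: "inj_on g (A \<union> L)" "\<forall>a\<in>A \<union> L. g a \<in> P a"
    using insert.IH insert.prems by (meson insertCI order_trans)
  show ?case
  proof (cases "b \<in> L")
    case True
    then have "insert b A \<union> L = A \<union> L" by blast
    then show ?thesis using g by auto
  next
    case False
    then have new: "b \<notin> A \<union> L" using insert by blast
    have "card (g ` (A \<union> L)) < card (P b)"
    proof -
      have "card (g ` (A \<union> L)) \<le> card (A \<union> L)" using insert by (intro card_image_le) auto
      also have "\<dots> < card (insert b A \<union> L)" using new insert by simp
      also have "\<dots> \<le> card (P b)" using insert.prems False by blast
      finally show ?thesis .
    qed
    then have "\<not> P b \<subseteq> g ` (A \<union> L)"
      using insert by (meson card_mono finite_UnI finite_imageI linorder_not_less)
    then obtain y where y: "y \<in> P b" "y \<notin> g ` (A \<union> L)" by blast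
    have "inj_on (g(b := y)) (insert b A \<union> L)"
      using g(1) y(2) new by (auto simp: inj_on_def)
    moreover have "\<forall>a\<in>insert b A \<union> L. (g(b := y)) a \<in> P a" using g(2) y(1) by auto
    ultimately show ?thesis by blast
  qed
qed

text \<open>The elements of \<open>L\<close> have few candidates, so they choose first.\<close>

lemma two_phase_injective_choice:
  assumes "finite A" "\<And>a. a \<in> A \<Longrightarrow> a \<in> L \<Longrightarrow> card (A \<inter> L) \<le> card (P a)"
    and "\<And>a. a \<in> A \<Longrightarrow> a \<notin> L \<Longrightarrow> card A \<le> card (P a)"
  shows "\<exists>f. inj_on f A \<and> (\<forall>a\<in>A. f a \<in> P a)"
proof -
  obtain f where "inj_on f (A \<inter> L)" "\<forall>a\<in>A \<inter> L. f a \<in> P a"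
    using extend_injective_choice[of "A \<inter> L" "{}" undefined P] assms by auto
  then show ?thesis
    using extend_injective_choice[of A "A \<inter> L" f P] assms by (auto simp: Un_absorb2)
qed

subsection \<open>Weights of cliques\<close>

lemma sum_edges_at_vertex:
  fixes w :: "'a set \<Rightarrow> real"
  assumes "v \<in> S"
  shows "(\<Sum>e\<in>{e \<in> nsets S 2. v \<in> e}. w e) = (\<Sum>u\<in>S - {v}. w {v, u})"
proof (rule sum.reindex_bij_betw[symmetric])
  show "bij_betw (\<lambda>u. {v, u}) (S - {v}) {e \<in> nsets S 2. v \<in> e}"
    using assms by (auto simp: bij_betw_def inj_on_def nsets_2_eq doubleton_eq_iff)
qed

lemma sum_degrees_eq_twice_weight:
  fixes w :: "'a set \<Rightarrow> real"
  assumes "finite S"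
  shows "(\<Sum>v\<in>S. \<Sum>u\<in>S - {v}. w {v, u}) = 2 * (\<Sum>e\<in>nsets S 2. w e)"
proof -
  have "(\<Sum>v\<in>S. \<Sum>u\<in>S - {v}. w {v, u}) = (\<Sum>v\<in>S. \<Sum>e\<in>{e \<in> nsets S 2. v \<in> e}. w e)"
    by (simp add: sum_edges_at_vertex)
  also have "\<dots> = (\<Sum>e\<in>nsets S 2. \<Sum>v\<in>{v \<in> S. v \<in> e}. w e)"
    using assms by (intro sum.swap_restrict finite_imp_finite_nsets)
  also have "\<dots> = (\<Sum>e\<in>nsets S 2. 2 * w e)"
  proof (intro sum.cong refl)
    fix e assume e: "e \<in> nsets S 2"
    then have "{v \<in> S. v \<in> e} = e" by (auto simp: nsets_def)
    then show "(\<Sum>v\<in>{v \<in> S. v \<in> e}. w e) = 2 * w e" using e by (simp add: nsets_def)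
  qed
  finally show ?thesis by (simp add: sum_distrib_left)
qed

text \<open>Removing \<open>e\<close> is a bijection onto the \<open>(r - k)\<close>-subsets of
  \<open>S - e\<close>. With \<open>k = 2\<close> this is the multiplicity of an edge when averaging
  over \<open>r\<close>-subsets.\<close>

lemma card_nsets_containing:
  assumes "finite S" "e \<in> nsets S k" "k \<le> r"
  shows "card {C \<in> nsets S r. e \<subseteq> C} = (card S - k) choose (r - k)"
proof -
  have e: "e \<subseteq> S" "finite e" "card e = k" using assms by (auto simp: nsets_def)
  have "bij_betw (\<lambda>C. C \<union> e) (nsets (S - e) (r - k)) {C \<in> nsets S r. e \<subseteq> C}"
  proof (rule bij_betw_byWitness[where f' = "\<lambda>C. C - e"])
    show "(\<lambda>C. C \<union> e) ` nsets (S - e) (r - k) \<subseteq> {C \<in> nsets S r. e \<subseteq> C}"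
    proof clarsimp
      fix C assume C: "C \<in> nsets (S - e) (r - k)"
      then have "card (C \<union> e) = (r - k) + k"
        using e by (subst card_Un_disjoint) (auto simp: nsets_def)
      then show "C \<union> e \<in> nsets S r" using C e assms(3) by (auto simp: nsets_def)
    qed
    show "(\<lambda>C. C - e) ` {C \<in> nsets S r. e \<subseteq> C} \<subseteq> nsets (S - e) (r - k)"
      using e by (auto simp: nsets_def card_Diff_subset)
  qed (auto simp: nsets_def)
  then have "card {C \<in> nsets S r. e \<subseteq> C} = card (nsets (S - e) (r - k))"
    by (metis bij_betw_same_card)
  also have "\<dots> = (card S - k) choose (r - k)"
    using e assms(1) by (simp add: card_Diff_subset)
  finally show ?thesis .
qed

text \<open>Averaging: every edge of \<open>S\<close> lies in equally many \<open>r\<close>-subsets,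
  so the density of \<open>S\<close> is the mean of their densities.\<close>

lemma weight_le_of_subclique_weights_le:
  assumes S: "finite S" "r \<le> card S" "2 \<le> r"
    and le: "\<And>C. C \<subseteq> S \<Longrightarrow> card C = r \<Longrightarrow> clique_weight w C \<le> t * real (r choose 2)"
  shows "clique_weight w S \<le> t * real (card S choose 2)"
proof -
  let ?c = "real ((card S - 2) choose (r - 2))"
  have pos: "?c > 0" using S by (simp add: zero_less_binomial)
  have "clique_weight w S * ?c = (\<Sum>e\<in>nsets S 2. \<Sum>C\<in>{C \<in> nsets S r. e \<subseteq> C}. w e)"
    unfolding clique_weight_def sum_distrib_right
    using S card_nsets_containing[OF S(1)] by (intro sum.cong refl) (simp add: mult.commute)
  also have "\<dots> = (\<Sum>C\<in>nsets S r. \<Sum>e\<in>{e \<in> nsets S 2. e \<subseteq> C}. w e)"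
    using S by (intro sum.swap_restrict finite_imp_finite_nsets)
  also have "\<dots> = (\<Sum>C\<in>nsets S r. clique_weight w C)"
    unfolding clique_weight_def
    by (intro sum.cong refl) (auto simp: nsets_def)
  also have "\<dots> \<le> (\<Sum>C\<in>nsets S r. t * real (r choose 2))"
    using le by (intro sum_mono) (auto simp: nsets_def)
  also have "\<dots> = t * real ((card S choose r) * (r choose 2))" using S by simp
  \<comment> \<open>Both sides count the pairs of an edge and an \<open>r\<close>-subset of
    \<open>S\<close> containing it.\<close>
  also have "(card S choose r) * (r choose 2) = (card S choose 2) * ((card S - 2) choose (r - 2))"
    using S by (intro choose_mult) auto
  finally have "clique_weight w S * ?c \<le> (t * real (card S choose 2)) * ?c"
    by (simp add: mult.assoc)
  then show ?thesis using pos by simp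
qed

lemma clique_weight_mono:
  assumes "c \<subseteq> C" "finite C" "\<And>e. e \<in> nsets C 2 \<Longrightarrow> 0 \<le> w e"
  shows "clique_weight w c \<le> clique_weight w C"
  unfolding clique_weight_def
  using assms by (intro sum_mono2 finite_imp_finite_nsets) (auto simp: nsets_def)

text \<open>Heavy terms are bounded by 1 and the others by \<open>s\<close>. This turns weighted
  degrees into degrees of the heavy graph.\<close>

lemma sum_le_card_heavy:
  fixes f :: "'a \<Rightarrow> real" and s :: real
  assumes "finite S" "\<And>v. v \<in> S \<Longrightarrow> f v \<le> 1" "0 \<le> s"
  shows "(\<Sum>v\<in>S. f v) \<le> card {v \<in> S. s \<le> f v} + s * card S"
proof -
  have "(\<Sum>v\<in>S. f v) \<le> (\<Sum>v\<in>S. (if s \<le> f v then 1 else 0) + s)"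
    using assms(2,3) by (intro sum_mono) fastforce
  also have "\<dots> = card {v \<in> S. s \<le> f v} + s * card S"
    using assms(1) by (simp add: sum.distrib sum.If_cases Int_def mult.commute)
  finally show ?thesis .
qed

section \<open>Packing disjoint good cliques under a weighted degree condition\<close>

text \<open>If a largest disjoint family of good \<open>r\<close>-sets has fewer than
  \<open>k\<close> members, the uncovered set \<open>S\<close> contains no good \<open>r\<close>-set
  and so has density at most \<open>t\<close>. The degrees then leave an average excess of at least
  \<open>(1 - t) * k\<close> per vertex of \<open>S\<close> for the fewer than \<open>r * k\<close>
  covered vertices. Each of these sends at most \<open>\<Delta> + s * card S\<close> to
  \<open>S\<close>, which is too little by \<open>num\<close>.\<close>

lemma disjoint_cliques_of_degree:
  fixes t \<Delta> :: real
  assumes B: "finite B" "card B = K + k" and r: "2 \<le> r" and K: "(r - 1) * k \<le> K" and t: "0 \<le> t"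
    and le1: "\<And>e. e \<in> nsets B 2 \<Longrightarrow> w e \<le> 1"
    and deg: "\<And>v. v \<in> B \<Longrightarrow> k + t * K \<le> (\<Sum>u\<in>B - {v}. w {v, u})"
    and heavy: "\<And>v. v \<in> B \<Longrightarrow> card {u \<in> B. u \<noteq> v \<and> t * (r choose 2) \<le> w {v, u}} \<le> \<Delta>"
    and num: "r * \<Delta> < (real K - real r * real k) * (1 - t - r * (t * real (r choose 2)))"
      "0 \<le> 1 - t - r * (t * real (r choose 2))"
  obtains G where "disjoint G" "card G = k" "finite G"
    "\<forall>C\<in>G. C \<subseteq> B \<and> card C = r \<and> t * (r choose 2) \<le> clique_weight w C"
proof -
  define s where "s = t * real (r choose 2)"
  define good where "good G \<longleftrightarrow> disjoint G \<and> finite G \<and>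
    (\<forall>C\<in>G. C \<subseteq> B \<and> card C = r \<and> s \<le> clique_weight w C)" for G
  have good_sub: "good G'" if "good G" "G' \<subseteq> G" for G G'
    using that unfolding good_def disjoint_def by (meson finite_subset subset_iff)
  have "\<exists>G. good G \<and> card G = k"
  proof (rule ccontr)
    assume none: "\<nexists>G. good G \<and> card G = k"
    have small: "card G < k" if "good G" for G
    proof (rule ccontr)
      assume "\<not> card G < k"
      then obtain G' where "G' \<subseteq> G" "card G' = k" using obtain_subset_with_card_n[of k G] by auto
      then show False using none good_sub that by blast
    qed
    have "good {}" by (simp add: good_def disjoint_def)
    moreover have "\<forall>G. good G \<longrightarrow> card G < k" using small by blast
    ultimately have "\<exists>G. good G \<and> (\<forall>G'. good G' \<longrightarrow> card G' \<le> card G)"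
      by (rule ex_has_greatest_nat)
    then obtain G where G: "good G" and max: "\<And>G'. good G' \<Longrightarrow> card G' \<le> card G"
      by (elim exE conjE) simp
    have Gfin: "finite G" "disjoint G" and GB: "\<Union>G \<subseteq> B" and Gr: "\<And>C. C \<in> G \<Longrightarrow> card C = r"
      using G by (auto simp: good_def)
    have finC: "finite C" if "C \<in> G" for C
      using that GB B(1) by (meson Sup_upper finite_subset)
    have jk: "card G < k" using small G by simp
    have cardUn: "card (\<Union>G) = r * card G"
      using card_Union_disjoint[of G] Gfin Gr finC by (simp add: disjoint_def pairwise_def disjnt_def)
    define S where "S = B - \<Union>G"
    have finS: "finite S" "S \<subseteq> B" using B by (auto simp: S_def)
    have "card S = K + k - r * card G"
      using B GB cardUn by (simp add: S_def card_Diff_subset finite_subset)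
    moreover have rj: "r * card G + r \<le> r * k" using jk
      by (metis Suc_leI mult_Suc_right mult_le_mono2 add.commute)
    moreover have "r * k \<le> K + k"
      using K r by (simp add: diff_mult_distrib)
    ultimately have cardS: "card S + r * card G = K + k" "r \<le> card S" by linarith+
    have bad: "clique_weight w C < s" if C: "C \<subseteq> S" "card C = r" for C
    proof (rule ccontr)
      assume nC: "\<not> clique_weight w C < s"
      have "C \<noteq> {}" using C r by auto
      have dC: "C \<inter> D = {}" if "D \<in> G" for D using C that by (auto simp: S_def)
      have "C \<notin> G" using dC \<open>C \<noteq> {}\<close> by blast
      moreover have "good (insert C G)"
        using G C nC finS dC unfolding good_def disjoint_def by (auto simp: Int_commute)
      ultimately show False using max[of "insert C G"] Gfin by simp
    qed
    have light: "(\<Sum>v\<in>S. w {x, v}) \<le> \<Delta> + s * card S" if x: "x \<in> \<Union>G" for x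
    proof -
      have xB: "x \<in> B" "x \<notin> S" using x GB by (auto simp: S_def)
      have s0: "0 \<le> s" using t by (simp add: s_def)
      have "w {x, v} \<le> 1" if "v \<in> S" for v
      proof -
        have "{x, v} \<in> nsets B 2" using that xB finS by (auto simp: nsets_2_eq)
        then show ?thesis by (rule le1)
      qed
      then have "(\<Sum>v\<in>S. w {x, v}) \<le> card {v \<in> S. s \<le> w {x, v}} + s * card S"
        using finS(1) s0 by (intro sum_le_card_heavy)
      also have "card {v \<in> S. s \<le> w {x, v}} \<le> card {u \<in> B. u \<noteq> x \<and> s \<le> w {x, u}}"
        using finS xB B by (intro card_mono) auto
      then have "card {v \<in> S. s \<le> w {x, v}} \<le> \<Delta>" using heavy[OF xB(1)] by (simp add: s_def)
      finally show ?thesis by simp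
    qed
    \<comment> \<open>Summing degrees over \<open>S\<close> counts edges inside \<open>S\<close>
      twice and edges to the covered vertices once.\<close>
    have "card S * (k + t * K) = (\<Sum>v\<in>S. k + t * K)" by simp
    also have "\<dots> \<le> (\<Sum>v\<in>S. \<Sum>u\<in>B - {v}. w {v, u})"
      using deg finS by (intro sum_mono) blast
    also have "\<dots> = (\<Sum>v\<in>S. (\<Sum>u\<in>S - {v}. w {v, u}) + (\<Sum>u\<in>\<Union>G. w {v, u}))"
    proof (rule sum.cong[OF refl])
      fix v assume "v \<in> S"
      then have "B - {v} = (S - {v}) \<union> \<Union>G" using GB by (auto simp: S_def)
      then show "(\<Sum>u\<in>B - {v}. w {v, u}) = (\<Sum>u\<in>S - {v}. w {v, u}) + (\<Sum>u\<in>\<Union>G. w {v, u})"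
        using finS GB B by (subst sum.union_disjoint[symmetric]) (auto simp: S_def intro: finite_subset)
    qed
    also have "\<dots> = 2 * clique_weight w S + (\<Sum>x\<in>\<Union>G. \<Sum>v\<in>S. w {x, v})"
      unfolding sum.distrib sum_degrees_eq_twice_weight[OF finS(1)] clique_weight_def
      by (subst (2) sum.swap) (simp add: insert_commute)
    also have "\<dots> \<le> 2 * (t * (card S choose 2)) + (\<Sum>x\<in>\<Union>G. \<Delta> + s * card S)"
      using weight_le_of_subclique_weights_le[OF finS(1) cardS(2) r, of w t] bad light
      by (intro add_mono sum_mono mult_left_mono) (auto simp: s_def less_imp_le)
    also have "2 * (t * (card S choose 2)) = t * (card S * (real (card S) - 1))"
    proof -
      have "2 * (card S choose 2) = card S * (card S - 1)"
        unfolding choose_two by (rule dvd_mult_div_cancel) (cases "card S", auto)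
      then have "2 * real (card S choose 2) = real (card S * (card S - 1))"
        by (metis of_nat_mult of_nat_numeral)
      then show ?thesis using cardS r by simp
    qed
    \<comment> \<open>Weakening \<open>card S - 1\<close> to \<open>K + k\<close> lets
      \<open>t * K\<close> cancel against the degree bound, so that \<open>k\<close> becomes a
      common factor.\<close>
    also have "\<dots> \<le> t * (real (card S) * (real K + real k))"
    proof (intro mult_left_mono)
      have "card S \<le> K + k" using cardS(1) by linarith
      then have "real (card S) \<le> real (K + k)" by (rule of_nat_mono)
      then show "real (card S) - 1 \<le> real K + real k" by simp
    qed (use t in auto)
    also have "(\<Sum>x\<in>\<Union>G. \<Delta> + s * card S) = (r * card G) * (\<Delta> + s * card S)"
      using cardUn by simp
    also have "\<dots> \<le> (r * k) * (\<Delta> + s * card S)"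
    proof (intro mult_right_mono)
      obtain v where "v \<in> B" using cardS r finS by fastforce
      then have "0 \<le> \<Delta>" using heavy[of v] by linarith
      then show "0 \<le> \<Delta> + s * card S" using t by (simp add: s_def)
      show "real (r * card G) \<le> real (r * k)" using jk by (intro of_nat_mono) simp
    qed
    finally have "k * (card S * (1 - t - r * s)) \<le> k * (r * \<Delta>)"
      by (simp add: algebra_simps)
    then have "card S * (1 - t - r * s) \<le> r * \<Delta>" using jk by simp
    moreover have "(real K - real r * real k) * (1 - t - r * s) \<le> card S * (1 - t - r * s)"
    proof (intro mult_right_mono)
      have "K \<le> card S + r * k" using cardS rj by linarith
      then have "real K \<le> real (card S + r * k)" by (rule of_nat_mono)
      then show "real K - real r * real k \<le> card S" by simp
    qed (use num(2) in \<open>simp add: s_def\<close>)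
    ultimately show False using num(1) by (simp add: s_def)
  qed
  then show ?thesis using that by (auto simp: good_def s_def)
qed

subsection \<open>Existence of heavy clique factors\<close>

text \<open>Counting non-edges between \<open>I\<close> and its complement \<open>J\<close> shows
  that all but \<open>16 * D\<close> vertices of \<open>J\<close> see at least three quarters of
  \<open>I\<close>. Only vertices of \<open>J\<close> with few neighbours in \<open>I\<close> are
  left out of \<open>A\<close>; there are so few of them that degrees in \<open>V - A\<close> stay
  small.\<close>

lemma bipartition_of_near_extremal_graph:
  fixes V :: "'a set" and D :: real
  assumes V: "finite V" "card V = r * N" "r \<ge> 3" "N \<ge> 1"
    and E: "symp E"
    and D: "0 \<le> D" "100 * (real r)\<^sup>2 * D \<le> N"
    and deg: "\<forall>v\<in>V. real N - D \<le> card {u\<in>V. E v u}"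
    and I: "I \<subseteq> V" "\<forall>u\<in>I. \<forall>v\<in>I. \<not> E u v" "card (V - I) \<le> N + 3 * D"
  obtains A where "A \<subseteq> V" "N - 17 * D \<le> card A"
    "\<forall>v\<in>V - A. card {u\<in>V - A. E v u} \<le> N / (4 * real r) + 16 * D"
    "\<forall>A' R. A' \<subseteq> A \<and> card A' \<le> N \<and> finite R \<and> card R \<le> 17 * real r * D \<longrightarrow>
      (\<exists>f. inj_on f A' \<and> (\<forall>a\<in>A'. f a \<in> V - A - R \<and> E a (f a)))"
proof -
  have sym: "E u v \<Longrightarrow> E v u" for u v using E by (rule sympD)
  have rD: "100 * (r * D) \<le> N / r"
    using D(2) V(3) by (simp add: field_simps power2_eq_square)
  have Nr: "N / r \<le> N / 3" using V(3) by (intro divide_left_mono) auto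
  have D3: "3 * D \<le> r * D" using V(3) D(1) by (intro mult_right_mono) auto
  define J where "J = V - I"
  define i where "i = real (card I)"
  define d where "d a = card {u\<in>I. E a u}" for a
  \<comment> \<open>This cutoff is small enough for the degrees in \<open>V - A\<close>, as
    \<open>r * g = N / 4\<close>, and \<open>g \<ge> 25 * (r * D)\<close> still leaves every vertex
    of \<open>A\<close> enough candidates.\<close>
  define g where "g = N / (4 * real r)"
  define L where "L = {v\<in>J. real (d v) < 3 / 4 * i}"
  define A where "A = {v\<in>J. g \<le> d v}"
  have fin: "finite I" "finite J" "finite L" "finite A"
    using V(1) I(1) by (auto simp: J_def L_def A_def intro: finite_subset)
  have g4: "4 * g = N / r" by (simp add: g_def)
  have cardJ: "card J \<le> N + 3 * D" using I(3) by (simp add: J_def)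
  have "card I + card J = r * N"
    using V(1,2) I(1) by (simp add: J_def card_Diff_subset finite_subset card_mono flip: V(2))
  then have "i + card J = real r * N" by (metis i_def of_nat_add of_nat_mult)
  moreover have "3 * real N \<le> real r * real N" using V(3) by (intro mult_right_mono) auto
  ultimately have i: "2 * real N - 3 * D \<le> i" using cardJ by linarith
  have Npos: "real N \<ge> 1" using V(4) by simp
  have ipos: "0 < i" using i D3 rD Nr Npos by linarith
  have gi: "g \<le> 3 / 4 * i" using i D3 rD Nr Npos g4 by linarith
  have nbI: "{u\<in>V. E v u} = {u\<in>J. E v u}" if "v \<in> I" for v
    using that I by (auto simp: J_def)
  \<comment> \<open>The neighbours of \<open>v\<close>, at least \<open>N - D\<close> of them, all
    lie in \<open>J\<close>, which has at most \<open>N + 3 * D\<close> vertices.\<close>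
  have miss: "card {u\<in>J. \<not> E v u} \<le> 4 * D" if "v \<in> I" for v
  proof -
    have "card J = card ({u\<in>J. E v u} \<union> {u\<in>J. \<not> E v u})"
      by (rule arg_cong[where f = card]) blast
    also have "\<dots> = card {u\<in>J. E v u} + card {u\<in>J. \<not> E v u}"
      using fin by (intro card_Un_disjoint) auto
    finally have "card J = card {u\<in>J. E v u} + card {u\<in>J. \<not> E v u}" .
    moreover have "real N - D \<le> card {u\<in>J. E v u}"
      using deg that I(1) unfolding nbI[OF that, symmetric] by blast
    ultimately show ?thesis using cardJ by simp
  qed
  have compl: "i = d u + card {v\<in>I. \<not> E v u}" for u
  proof -
    have "card I = card ({v\<in>I. E u v} \<union> {v\<in>I. \<not> E v u})"
      using sym by (intro arg_cong[where f = card]) blast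
    also have "\<dots> = d u + card {v\<in>I. \<not> E v u}"
      unfolding d_def using fin sym by (intro card_Un_disjoint) auto
    finally show ?thesis by (simp add: i_def)
  qed
  \<comment> \<open>Each vertex of \<open>L\<close> misses more than a quarter of \<open>I\<close>,
    and each vertex of \<open>I\<close> is missed by at most \<open>4 * D\<close> vertices of
    \<open>J\<close>.\<close>
  have "card L * (i / 4) = (\<Sum>u\<in>L. i / 4)" by simp
  also have "\<dots> \<le> (\<Sum>u\<in>L. real (card {v\<in>I. \<not> E v u}))"
  proof (rule sum_mono)
    fix u assume "u \<in> L"
    then have "real (d u) < 3 / 4 * i" by (simp add: L_def)
    then show "i / 4 \<le> real (card {v\<in>I. \<not> E v u})" using compl[of u] by simp
  qed
  also have "\<dots> \<le> (\<Sum>u\<in>J. real (card {v\<in>I. \<not> E v u}))"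
    using fin by (intro sum_mono2) (auto simp: L_def)
  also have "\<dots> = (\<Sum>v\<in>I. real (card {u\<in>J. \<not> E v u}))"
    using sum_card_swap[OF fin(1,2), of "\<lambda>v u. \<not> E v u"] unfolding of_nat_sum[symmetric] by simp
  also have "\<dots> \<le> (\<Sum>v\<in>I. 4 * D)" using miss by (intro sum_mono)
  finally have "card L * i \<le> 16 * D * i" by (simp add: i_def mult_ac)
  then have cardL: "card L \<le> 16 * D" using ipos by simp
  have ZL: "J - A \<subseteq> L" using gi by (auto simp: A_def L_def)
  then have cardZ: "card (J - A) \<le> 16 * D"
    using card_mono[OF fin(3) ZL] cardL by linarith
  have split: "V - A = I \<union> (J - A)" using I(1) by (auto simp: J_def A_def)
  show ?thesis
  proof (rule that[of A]; (intro ballI allI impI)?; (elim conjE)?)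
    show "A \<subseteq> V" by (auto simp: A_def J_def)
    \<comment> \<open>Any vertex of \<open>I\<close> shows \<open>card J \<ge> N - D\<close>;
      leaving out at most \<open>16 * D\<close> vertices accounts for \<open>17 * D\<close>.\<close>
    obtain v where v: "v \<in> I" using ipos by (auto simp: i_def card_gt_0_iff)
    have "real N - D \<le> card {u\<in>J. E v u}"
      using deg v I(1) unfolding nbI[OF v, symmetric] by blast
    also have "\<dots> \<le> card J" using fin by (auto intro!: card_mono)
    also have "card J = card A + card (J - A)"
    proof -
      have "A \<subseteq> J" by (auto simp: A_def)
      then show ?thesis using fin by (simp add: card_Diff_subset card_mono)
    qed
    finally show "N - 17 * D \<le> card A" using cardZ by simp
  next
    fix v assume "v \<in> V - A"
    then consider "v \<in> I" | "v \<in> J - A" using split by blast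
    then show "card {u\<in>V - A. E v u} \<le> N / (4 * real r) + 16 * D"
    proof cases
      case 1
      then have "{u\<in>V - A. E v u} \<subseteq> J - A" using split I(2) by blast
      then have "card {u\<in>V - A. E v u} \<le> card (J - A)" using fin by (intro card_mono) auto
      moreover have "0 \<le> N / (4 * real r)" by simp
      ultimately show ?thesis using cardZ by linarith
    next
      case 2
      have "{u\<in>V - A. E v u} \<subseteq> {u\<in>I. E v u} \<union> (J - A)" using split by blast
      then have "card {u\<in>V - A. E v u} \<le> card ({u\<in>I. E v u} \<union> (J - A))"
        using fin by (intro card_mono) auto
      also have "\<dots> \<le> d v + card (J - A)" unfolding d_def by (rule card_Un_le)
      finally have "card {u\<in>V - A. E v u} \<le> d v + card (J - A)" .
      moreover have "d v < g" using 2 by (auto simp: A_def)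
      ultimately show ?thesis using cardZ unfolding g_def by linarith
    qed
  next
    \<comment> \<open>\<open>R\<close> stands for the vertices of at most \<open>17 * D\<close>
      cliques of size \<open>r\<close>, which the matching has to avoid.\<close>
    fix A' R :: "'a set" assume A': "A' \<subseteq> A" "card A' \<le> N" and R: "finite R" "card R \<le> 17 * real r * D"
    define P where "P a = {u\<in>I. E a u} - R" for a
    have cardP: "d a - 17 * (r * D) \<le> card (P a)" for a
    proof -
      have "d a - card R \<le> card (P a)" unfolding d_def P_def using R(1) by (rule diff_card_le_card_Diff)
      then show ?thesis using R(2) by (simp add: mult.assoc)
    qed
    have "\<exists>f. inj_on f A' \<and> (\<forall>a\<in>A'. f a \<in> P a)"
    proof (rule two_phase_injective_choice[where L = L])
      show "finite A'" using A'(1) fin finite_subset by blast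
      \<comment> \<open>The candidates number at least
        \<open>g - 17 * (r * D) \<ge> 8 * (r * D) \<ge> 24 * D\<close>, enough for
        \<open>card L \<le> 16 * D\<close>.\<close>
      show "card (A' \<inter> L) \<le> card (P a)" if "a \<in> A'" "a \<in> L" for a
      proof -
        have "g \<le> d a" using that A' by (auto simp: A_def)
        moreover have "card (A' \<inter> L) \<le> card L" using fin by (intro card_mono) auto
        ultimately have "real (card (A' \<inter> L)) \<le> card (P a)"
          using cardP[of a] cardL rD D3 g4 by linarith
        then show ?thesis by simp
      qed
      \<comment> \<open>Three quarters of \<open>i \<ge> 2 * N - 3 * D\<close> still leave
        \<open>N\<close> candidates after \<open>17 * (r * D)\<close> are removed.\<close>
      show "card A' \<le> card (P a)" if "a \<in> A'" "a \<notin> L" for a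
      proof -
        have "3 / 4 * i \<le> d a" using that A' by (auto simp: A_def L_def)
        then have "real N \<le> card (P a)" using cardP[of a] i rD D3 Nr Npos by linarith
        then show ?thesis using A'(2) by simp
      qed
    qed
    then show "\<exists>f. inj_on f A' \<and> (\<forall>a\<in>A'. f a \<in> V - A - R \<and> E a (f a))"
      using split by (auto simp: P_def)
  qed
qed

section \<open>Assembling a factor from heavy edges and good cliques\<close>

lemma clique_weight_edge:
  assumes "u \<noteq> v" shows "clique_weight w {u, v} = w {u, v}"
proof -
  have "nsets {u, v} 2 = {{u, v}}" using assms by (auto simp: nsets_2_eq doubleton_eq_iff)
  then show ?thesis by (simp add: clique_weight_def)
qed

text \<open>Without such a factor there are no \<open>N\<close> disjoint good sets of size at most
  \<open>r\<close> (\<open>no_family\<close>). For heavy edges this yields the near-extremal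
  structure; for heavy edges at \<open>A\<close> together with good cliques outside \<open>A\<close>
  it yields the contradiction.\<close>

lemma heavy_clique_factor:
  fixes t :: real
  assumes r: "r \<ge> 3" and N: "N \<ge> 1" and t: "0 \<le> t"
    and small: "100 * (real r)\<^sup>2 * (t * (r choose 2) * r) \<le> 1"
    and w: "w \<in> edge_weightings (r * N)"
    and deg: "\<And>v. v < r * N \<Longrightarrow> N + t * (real r * N - N) \<le> weighted_degree (r * N) w v"
  shows "\<exists>F. clique_factor r (r * N) F \<and> (\<forall>C\<in>F. t * (r choose 2) \<le> clique_weight w C)"
proof (rule ccontr)
  assume none: "\<not> ?thesis"
  define V where "V = {..<r * N}"
  have V: "finite V" "card V = r * N" by (auto simp: V_def)
  define s where "s = t * real (r choose 2)"
  define D where "D = s * r * N"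
  define E where "E u v \<longleftrightarrow> u \<in> V \<and> v \<in> V \<and> u \<noteq> v \<and> s \<le> w {u, v}" for u v
  have s0: "0 \<le> s" and D0: "0 \<le> D" using t by (auto simp: s_def D_def)
  have w01: "0 \<le> w e" "w e \<le> 1" if "e \<in> nsets V 2" for e
    using w that by (auto simp: edge_weightings_def V_def PiE_def Pi_def)
  have edge: "{u, v} \<in> nsets V 2" if "u \<in> V" "v \<in> V" "u \<noteq> v" for u v
    using that by (auto simp: nsets_2_eq)
  have sym: "E u v \<Longrightarrow> E v u" for u v by (auto simp: E_def insert_commute)
  have irr: "\<not> E v v" for v by (simp add: E_def)
  have degV: "N + t * (real r * N - N) \<le> (\<Sum>u\<in>V - {v}. w {v, u})" if "v \<in> V" for v
    using deg[of v] that sum_edges_at_vertex[OF that, of w] by (simp add: weighted_degree_def V_def)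
  \<comment> \<open>Light edges contribute at most \<open>s\<close> each, hence at most
    \<open>D\<close> in total at a vertex.\<close>
  have degE: "real N - D \<le> card {u\<in>V. E v u}" if v: "v \<in> V" for v
  proof -
    have "(\<Sum>u\<in>V - {v}. w {v, u}) \<le> card {u\<in>V - {v}. s \<le> w {v, u}} + s * card (V - {v})"
      using V w01 edge v s0 by (intro sum_le_card_heavy) auto
    also have "{u\<in>V - {v}. s \<le> w {v, u}} = {u\<in>V. E v u}" using v by (auto simp: E_def)
    also have "s * card (V - {v}) \<le> s * card V"
      using V s0 by (intro mult_left_mono of_nat_mono card_mono) auto
    also have "s * card V = D" using V by (simp add: D_def)
    finally have "N + t * (real r * N - N) \<le> card {u\<in>V. E v u} + D" using degV[OF v] by linarith
    moreover have "1 * real N \<le> real r * real N" using r by (intro mult_right_mono) auto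
    then have "0 \<le> t * (real r * N - N)" using t by simp
    ultimately show ?thesis by linarith
  qed
  have D100: "100 * (real r)\<^sup>2 * D \<le> N"
  proof -
    have "100 * (real r)\<^sup>2 * (s * r) * N \<le> 1 * real N"
      using small by (intro mult_right_mono) (auto simp: s_def)
    then show ?thesis by (simp add: D_def mult.assoc)
  qed
  \<comment> \<open>Weights are nonnegative, so good sets stay good when enlarged to size
    \<open>r\<close>.\<close>
  have no_family: "card G \<noteq> N" if G: "disjoint G"
    "\<And>C. C \<in> G \<Longrightarrow> C \<subseteq> V \<and> card C \<le> r \<and> s \<le> clique_weight w C" for G
  proof
    assume "card G = N"
    then obtain F where F: "partition_on V F" "\<forall>C\<in>F. card C = r \<and> (\<exists>c\<in>G. c \<subseteq> C)"
      using disjoint_extends_to_partition[of V r N G] V r G by auto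
    have "s \<le> clique_weight w C" if C: "C \<in> F" for C
    proof -
      obtain c where c: "c \<in> G" "c \<subseteq> C" using F C by blast
      have "C \<subseteq> V" using F(1) C by (auto simp: partition_on_def)
      then have "clique_weight w c \<le> clique_weight w C"
        using c V(1) w01(1) by (intro clique_weight_mono) (auto simp: nsets_def intro: finite_subset)
      then show ?thesis using G(2) c by fastforce
    qed
    then have "clique_factor r (r * N) F \<and> (\<forall>C\<in>F. t * (r choose 2) \<le> clique_weight w C)"
      using F by (auto simp: clique_factor_def V_def s_def)
    then show False using none by blast
  qed
  have edge_good: "{u, v} \<subseteq> V \<and> card {u, v} \<le> r \<and> s \<le> clique_weight w {u, v}" if "E u v" for u v
    using that r by (simp add: E_def clique_weight_edge)
  have "card M < N" if M: "matching V E M" for M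
  proof (rule ccontr)
    assume "\<not> card M < N"
    then obtain G where G: "G \<subseteq> M" "card G = N" using obtain_subset_with_card_n[of N M] by auto
    have "disjoint G" using M G(1) unfolding matching_def disjoint_def by blast
    moreover have "C \<subseteq> V \<and> card C \<le> r \<and> s \<le> clique_weight w C" if "C \<in> G" for C
    proof -
      have "C \<in> M" using that G(1) by blast
      then obtain u v where "E u v" "C = {u, v}" using M unfolding matching_def by blast
      then show ?thesis using edge_good by simp
    qed
    ultimately show False using no_family G(2) by blast
  qed
  then obtain I where I: "I \<subseteq> V" "\<And>u v. u \<in> I \<Longrightarrow> v \<in> I \<Longrightarrow> \<not> E u v" "card (V - I) \<le> N + 3 * D"
    using large_independent_set[OF V r D0 sym irr degE] by blast
  obtain A where A: "A \<subseteq> V" "N - 17 * D \<le> card A"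
    "\<forall>v\<in>V - A. card {u\<in>V - A. E v u} \<le> N / (4 * real r) + 16 * D"
    and match: "\<forall>A' R. A' \<subseteq> A \<and> card A' \<le> N \<and> finite R \<and> card R \<le> 17 * real r * D \<longrightarrow>
      (\<exists>f. inj_on f A' \<and> (\<forall>a\<in>A'. f a \<in> V - A - R \<and> E a (f a)))"
    by (rule bipartition_of_near_extremal_graph[OF V r N _ D0 D100 _ I(1) _ I(3), of E])
      (use sym degE I(2) that in \<open>auto simp: symp_def\<close>)
  \<comment> \<open>The vertices of \<open>G\<close> are the forbidden set \<open>R\<close> when
    \<open>A'\<close> is matched into the rest of \<open>V - A\<close>.\<close>
  have combine: "card G + card A' \<noteq> N" if A': "A' \<subseteq> A" and G: "disjoint G" "finite G"
    "\<And>C. C \<in> G \<Longrightarrow> C \<subseteq> V - A \<and> card C = r \<and> s \<le> clique_weight w C"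
    "r * card G \<le> 17 * real r * D" for G A'
  proof
    assume sum: "card G + card A' = N"
    have "\<Union>G \<subseteq> V" using G(3) by blast
    then have finU: "finite (\<Union>G)" using V(1) by (rule finite_subset)
    have "card (\<Union>G) \<le> (\<Sum>C\<in>G. card C)" by (rule card_Union_le_sum_card)
    also have "\<dots> = r * card G" using G(3) by simp
    finally have "real (card (\<Union>G)) \<le> real (r * card G)" by (rule of_nat_mono)
    then have "card (\<Union>G) \<le> 17 * real r * D" using G(4) by linarith
    then obtain f where f: "inj_on f A'" "\<And>a. a \<in> A' \<Longrightarrow> f a \<in> V - A - \<Union>G \<and> E a (f a)"
      using match A' sum finU by (metis le_add2)
    define h where "h a = {a, f a}" for a
    have hd: "h a \<inter> h b = {}" if "a \<in> A'" "b \<in> A'" "a \<noteq> b" for a b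
      using that f A' unfolding h_def inj_on_def by blast
    have hG: "h a \<inter> C = {}" if "a \<in> A'" "C \<in> G" for a C
      using that f(2) A' G(3) unfolding h_def by blast
    have hne: "h a \<noteq> {}" for a by (simp add: h_def)
    have injh: "inj_on h A'"
      using hd hne by (intro inj_onI) (metis inf.idem)
    have "h ` A' \<inter> G = {}" using hG hne by fastforce
    moreover have "finite A'" using A' A(1) V(1) by (meson finite_subset)
    ultimately have "card (h ` A' \<union> G) = N"
      using sum G(2) injh by (simp add: card_Un_disjoint card_image)
    moreover have "disjoint (h ` A' \<union> G)"
      using G(1) hd hG unfolding disjoint_def by (metis Int_commute UnE imageE)
    moreover have "C \<subseteq> V \<and> card C \<le> r \<and> s \<le> clique_weight w C" if "C \<in> h ` A' \<union> G" for C
      using that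
    proof
      assume "C \<in> h ` A'"
      then show ?thesis using f(2) edge_good unfolding h_def by blast
    next
      assume "C \<in> G"
      then show ?thesis using G(3) by fastforce
    qed
    ultimately show False using no_family by blast
  qed
  have cardA: "card A < N"
  proof (rule ccontr)
    assume "\<not> card A < N"
    then obtain A' where "A' \<subseteq> A" "card A' = N" using obtain_subset_with_card_n[of N A] by auto
    then show False using combine[of A' "{}"] D0 by simp
  qed
  define k where "k = N - card A"
  define K where "K = (r - 1) * N"
  have k: "k + card A = N" "real k \<le> 17 * D" using cardA A(2) by (auto simp: k_def)
  have K: "real K = real r * N - N" "K + N = r * N"
    using r by (auto simp: K_def algebra_simps)
  have rD: "100 * (r * D) \<le> N / r"
    using D100 r by (simp add: field_simps power2_eq_square)
  have Nr: "N / r \<le> N / 3" using r by (intro divide_left_mono) auto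
  obtain G where G: "disjoint G" "card G = k" "finite G"
    "\<forall>C\<in>G. C \<subseteq> V - A \<and> card C = r \<and> t * (r choose 2) \<le> clique_weight w C"
  proof (rule disjoint_cliques_of_degree[of "V - A" K k r t w "N / (4 * real r) + 16 * D"])
    show "finite (V - A)" using V by simp
    show "card (V - A) = K + k"
      using A(1) V K(2) k(1) by (simp add: card_Diff_subset finite_subset)
    show "2 \<le> r" using r by simp
    show "0 \<le> t" by (rule t)
    show "(r - 1) * k \<le> K" unfolding K_def k_def by simp
    show "w e \<le> 1" if "e \<in> nsets (V - A) 2" for e
      using that by (intro w01(2)) (auto simp: nsets_def)
    \<comment> \<open>Deleting \<open>A\<close> costs at most \<open>card A = N - k\<close>, so
      \<open>N + t * K\<close> drops to no less than \<open>k + t * K\<close>.\<close>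
    show "real k + t * real K \<le> (\<Sum>u\<in>V - A - {v}. w {v, u})" if v: "v \<in> V - A" for v
    proof -
      have "V - {v} = (V - A - {v}) \<union> A" using A(1) v by blast
      then have "(\<Sum>u\<in>V - {v}. w {v, u}) = (\<Sum>u\<in>V - A - {v}. w {v, u}) + (\<Sum>u\<in>A. w {v, u})"
        using V(1) A(1) by (subst sum.union_disjoint[symmetric]) (auto intro: finite_subset)
      also have "(\<Sum>u\<in>A. w {v, u}) \<le> (\<Sum>u\<in>A. 1)"
        using v A(1) by (intro sum_mono w01(2) edge) auto
      finally have "N + t * K \<le> (\<Sum>u\<in>V - A - {v}. w {v, u}) + card A"
        using degV[of v] v K(1) by simp
      moreover have "real N = real k + card A" using k(1) by (metis of_nat_add)
      ultimately show ?thesis by linarith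
    qed
    show "card {u \<in> V - A. u \<noteq> v \<and> t * (r choose 2) \<le> w {v, u}} \<le> N / (4 * real r) + 16 * D"
      if v: "v \<in> V - A" for v
    proof -
      have "{u \<in> V - A. u \<noteq> v \<and> t * (r choose 2) \<le> w {v, u}} = {u\<in>V - A. E v u}"
        using v by (auto simp: E_def s_def)
      then show ?thesis using A(3) v by simp
    qed
    have "1 * t \<le> real (r choose 2) * t"
      using t r by (intro mult_right_mono) (auto simp: Suc_le_eq zero_less_binomial)
    then have ts: "t \<le> s" by (simp add: s_def mult.commute)
    have "1 * s \<le> r * s" using s0 r by (intro mult_right_mono) auto
    then have srs: "s \<le> r * s" by simp
    \<comment> \<open>This gives \<open>r * s \<le> 1 / 900\<close>, and
      \<open>t \<le> s \<le> r * s\<close>.\<close>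
    have "100 * 9 * (r * s) \<le> 100 * (real r)\<^sup>2 * (r * s)"
    proof -
      have "3\<^sup>2 \<le> (real r)\<^sup>2" using r by (intro power_mono) auto
      then show ?thesis using s0 by (intro mult_right_mono) auto
    qed
    also have "\<dots> \<le> 1" using small by (simp add: s_def mult_ac)
    finally have half: "1 / 2 \<le> 1 - t - r * s" using ts srs by linarith
    then show "0 \<le> 1 - t - r * (t * (r choose 2))" by (simp add: s_def)
    \<comment> \<open>The left side is below \<open>N / 2\<close> because
      \<open>r * D \<le> N / 300\<close>. On the right, \<open>K \<ge> 2 * N\<close> and
      \<open>k \<le> 17 * D\<close> make the first factor at least \<open>N\<close>, and the second
      is at least 1/2.\<close>
    have "r * (N / (4 * real r) + 16 * D) = N / 4 + 16 * (r * D)" using r by (simp add: field_simps)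
    also have "\<dots> < N * (1 / 2)" using rD Nr N by simp
    also have "\<dots> \<le> (real K - real r * real k) * (1 - t - r * s)"
    proof (intro mult_mono half)
      have "real r * real k \<le> real r * (17 * D)" using k(2) by (intro mult_left_mono) auto
      moreover have "3 * real N \<le> real r * real N" using r by (intro mult_right_mono) auto
      ultimately show "real N \<le> real K - real r * real k" using rD Nr K(1) by (simp add: mult.left_commute)
      then show "0 \<le> real K - real r * real k" by (meson of_nat_0_le_iff order_trans)
    qed auto
    finally show "r * (N / (4 * real r) + 16 * D) < (real K - real r * real k) * (1 - t - r * (t * real (r choose 2)))"
      by (simp add: s_def)
  qed blast
  have "real (r * card G) \<le> 17 * real r * D"
    using k(2) G(2) by (simp add: mult.assoc mult.left_commute mult_left_mono)
  then show False using combine[of A G] G k(1) by (auto simp: s_def)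
qed

subsection \<open>The extremal weighting and the threshold\<close>

lemma card_clique_factor:
  assumes "clique_factor r (r * N) F" "r > 0"
  shows "card F = N"
proof -
  have F: "partition_on {..<r * N} F" "\<And>C. C \<in> F \<Longrightarrow> card C = r"
    using assms(1) by (auto simp: clique_factor_def)
  have "card {..<r * N} = (\<Sum>C\<in>F. card C)"
    using F(1) by (intro product_partition) (auto simp: partition_on_def intro: finite_subset)
  also have "\<dots> = card F * r" using F(2) by simp
  finally show ?thesis using assms(2) by simp
qed

text \<open>A factor has \<open>N\<close> cliques, so one of them avoids the \<open>N - 1\<close>
  vertices of full weight and has density exactly \<open>x\<close>. It must be strictly too light,
  hence \<open>x < t\<close>.\<close>

lemma extremal_weighting:
  fixes x t :: real
  assumes r: "r \<ge> 2" and N: "N \<ge> 1" and x: "0 \<le> x" "x < t" "x \<le> 1"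
  obtains w where "w \<in> bad_weightings r t (r * N)"
    "real N - 1 + x * (real r * N - N) \<le> min_weighted_degree (r * N) w"
proof -
  define V where "V = {..<r * N}"
  define w where "w = restrict (\<lambda>e. if e \<inter> {..<N - 1} \<noteq> {} then 1 else x) (nsets V 2)"
  have rN: "N \<le> r * N" "V \<noteq> {}" using r N by (auto simp: V_def lessThan_empty_iff)
  have "\<exists>C\<in>F. clique_weight w C < t * real (r choose 2)" if F: "clique_factor r (r * N) F" for F
  proof -
    have FV: "partition_on V F" "\<And>C. C \<in> F \<Longrightarrow> card C = r"
      using F by (auto simp: clique_factor_def V_def)
    have "\<exists>C\<in>F. C \<inter> {..<N - 1} = {}"
    proof (rule ccontr)
      assume "\<not> ?thesis"
      then have "\<forall>C\<in>F. \<exists>u. u \<in> C \<inter> {..<N - 1}" by blast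
      then obtain h where h: "\<And>C. C \<in> F \<Longrightarrow> h C \<in> C \<inter> {..<N - 1}"
        unfolding bchoice_iff by blast
      have "inj_on h F"
        using h FV(1) unfolding partition_on_def disjoint_def inj_on_def by (metis IntD1 IntI empty_iff)
      moreover have "h ` F \<subseteq> {..<N - 1}" using h by blast
      ultimately have "card F \<le> N - 1" by (metis card_inj_on_le card_lessThan finite_lessThan)
      then show False using card_clique_factor[OF F] r N by simp
    qed
    then obtain C where C: "C \<in> F" "C \<inter> {..<N - 1} = {}" by blast
    have "C \<subseteq> V" using FV(1) C by (auto simp: partition_on_def)
    then have "clique_weight w C = (\<Sum>e\<in>nsets C 2. x)"
      unfolding clique_weight_def w_def using C(2)
      by (intro sum.cong refl) (auto simp: nsets_def)
    also have "\<dots> = x * real (r choose 2)" using FV(2) C(1) by simp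
    also have "\<dots> < t * real (r choose 2)"
      using x r by (intro mult_strict_right_mono) (auto simp: zero_less_binomial)
    finally show ?thesis using C by blast
  qed
  moreover have "w \<in> edge_weightings (r * N)"
    using x unfolding edge_weightings_def w_def V_def by (auto simp: PiE_def Pi_def extensional_def)
  ultimately have "w \<in> bad_weightings r t (r * N)" by (simp add: bad_weightings_def)
  moreover have "real N - 1 + x * (real r * N - N) \<le> weighted_degree (r * N) w v" if v: "v \<in> V" for v
  proof -
    let ?T = "{u \<in> V - {v}. u < N - 1 \<or> v < N - 1}"
    have "weighted_degree (r * N) w v = (\<Sum>u\<in>V - {v}. w {v, u})"
      using sum_edges_at_vertex[OF v] by (simp add: weighted_degree_def V_def)
    \<comment> \<open>Every edge carries \<open>x\<close>, plus a surplus \<open>1 - x\<close> if it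
      meets one of the first \<open>N - 1\<close> vertices; at least \<open>N - 1\<close> edges at
      \<open>v\<close> do.\<close>
    also have "\<dots> = (\<Sum>u\<in>V - {v}. x + (1 - x) * (if u < N - 1 \<or> v < N - 1 then 1 else 0))"
      using v by (intro sum.cong refl) (auto simp: w_def nsets_2_eq)
    also have "\<dots> = x * card (V - {v}) + (1 - x) * card ?T"
      by (simp add: sum.distrib sum.If_cases Int_def V_def flip: sum_distrib_left)
    finally have wd: "weighted_degree (r * N) w v = x * card (V - {v}) + (1 - x) * card ?T" .
    have "N - 1 \<le> card ?T"
    proof (cases "v < N - 1")
      case True
      then have "?T = V - {v}" by auto
      then have "card ?T = r * N - 1" using v by (simp add: V_def)
      then show ?thesis using rN(1) by linarith
    next
      case False
      have "u \<in> ?T" if u: "u < N - 1" for u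
      proof -
        have "u < r * N" "u \<noteq> v" using u rN(1) False by linarith+
        then show ?thesis using u by (simp add: V_def)
      qed
      then have "{..<N - 1} \<subseteq> ?T" by blast
      moreover have "finite ?T" by (simp add: V_def)
      ultimately show ?thesis by (metis card_lessThan card_mono)
    qed
    then have "(1 - x) * (real N - 1) \<le> (1 - x) * card ?T" using x N by (intro mult_left_mono) auto
    moreover have cv: "real (card (V - {v})) = real r * N - 1"
    proof -
      have "card (V - {v}) = r * N - 1" "1 \<le> r * N" using v rN N by (auto simp: V_def)
      then show ?thesis by simp
    qed
    ultimately show ?thesis unfolding wd cv by (simp add: algebra_simps)
  qed
  then have "real N - 1 + x * (real r * N - N) \<le> min_weighted_degree (r * N) w"
    unfolding min_weighted_degree_def using rN by (subst Min_ge_iff) (auto simp: V_def)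
  ultimately show ?thesis using that by blast
qed

text \<open>The upper bound is the contrapositive of \<open>heavy_clique_factor\<close>. For the
  lower bound \<open>x\<close> tends to \<open>t\<close> in the extremal weighting, as
  \<open>x = t\<close> itself would not be bad.\<close>

lemma degree_threshold_at_bounds:
  fixes t :: real
  assumes r: "r \<ge> 3" and N: "N \<ge> 1" and t: "0 < t" "t \<le> 1"
    and small: "100 * (real r)\<^sup>2 * (t * (r choose 2) * r) \<le> 1"
  shows "degree_threshold_at r t (r * N) \<le> N + t * (real r * N - N)"
    and "real N - 1 + t * (real r * N - N) \<le> degree_threshold_at r t (r * N)"
proof -
  have ne: "{..<r * N} \<noteq> {}" using r N by (auto simp: lessThan_empty_iff)
  have up: "min_weighted_degree (r * N) w \<le> N + t * (real r * N - N)"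
    if w: "w \<in> bad_weightings r t (r * N)" for w
  proof (rule ccontr)
    assume "\<not> ?thesis"
    then have "N + t * (real r * N - N) \<le> weighted_degree (r * N) w v" if "v < r * N" for v
      using that ne unfolding min_weighted_degree_def by (force simp: not_le)
    then obtain F where "clique_factor r (r * N) F" "\<forall>C\<in>F. t * (r choose 2) \<le> clique_weight w C"
      using heavy_clique_factor[OF r N _ small, of w] w t by (auto simp: bad_weightings_def)
    then show False using w by (force simp: bad_weightings_def)
  qed
  \<comment> \<open>The case \<open>x = 0\<close> provides nonemptiness, without which the supremum
    cannot be bounded.\<close>
  obtain w0 where "w0 \<in> bad_weightings r t (r * N)"
    using extremal_weighting[of r N 0 t] r N t by auto
  then show "degree_threshold_at r t (r * N) \<le> N + t * (real r * N - N)"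
    unfolding degree_threshold_at_def using up by (intro cSUP_least) auto
  define c where "c = real r * N - N"
  have "1 * real N < real r * N" using r N by (intro mult_strict_right_mono) auto
  then have c: "c > 0" by (simp add: c_def)
  have bdd: "bdd_above (min_weighted_degree (r * N) ` bad_weightings r t (r * N))"
    using up by (auto simp: bdd_above_def)
  have "t \<le> (degree_threshold_at r t (r * N) - (real N - 1)) / c"
  proof (rule dense_le_bounded[OF t(1)])
    fix x assume x: "0 < x" "x < t"
    obtain w where w: "w \<in> bad_weightings r t (r * N)"
      "real N - 1 + x * (real r * N - N) \<le> min_weighted_degree (r * N) w"
      using extremal_weighting[of r N x t] r N x t by auto
    note w(2)
    also have "min_weighted_degree (r * N) w \<le> degree_threshold_at r t (r * N)"
      unfolding degree_threshold_at_def using bdd w(1) by (rule cSUP_upper2) simp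
    finally show "x \<le> (degree_threshold_at r t (r * N) - (real N - 1)) / c"
      using c by (simp add: c_def field_simps)
  qed
  then show "real N - 1 + t * (real r * N - N) \<le> degree_threshold_at r t (r * N)"
    using c by (simp add: pos_le_divide_eq flip: c_def)
qed

section \<open>Passage to the limit\<close>

theorem theorem4:
  fixes r :: nat
  assumes "r \<ge> 3"
  shows "\<exists>t\<^sub>r::real. t\<^sub>r > 0 \<and>
    (\<forall>t\<in>{0<..<t\<^sub>r}. degree_threshold r t = ereal (1 / real r + (1 - 1 / real r) * t))"
proof (intro exI conjI ballI)
  \<comment> \<open>\<open>b * t \<le> 1\<close> is the smallness condition on \<open>t\<close> for
    the bounds at fixed \<open>n\<close>, and \<open>b \<ge> 1\<close> ensures
    \<open>t \<le> 1\<close>.\<close>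
  define b where "b = 100 * (real r)\<^sup>2 * (real (r choose 2) * real r)"
  have "1 * 1 \<le> (100 * (real r)\<^sup>2) * (real (r choose 2) * real r)"
  proof (intro mult_mono)
    have "(1::real)\<^sup>2 \<le> (real r)\<^sup>2" using assms by (intro power_mono) auto
    then show "1 \<le> 100 * (real r)\<^sup>2" by simp
    have "1 * 1 \<le> real (r choose 2) * real r"
      using assms by (intro mult_mono) (auto simp: Suc_le_eq zero_less_binomial)
    then show "1 \<le> real (r choose 2) * real r" by simp
  qed auto
  then have b: "1 \<le> b" by (simp add: b_def)
  then show "0 < 1 / b" by simp
  fix t assume "t \<in> {0<..<1 / b}"
  then have t: "0 < t" "t < 1 / b" by auto
  have tb: "b * t \<le> 1" using t(2) b by (simp add: field_simps)
  then have small: "100 * (real r)\<^sup>2 * (t * (r choose 2) * r) \<le> 1" by (simp add: b_def mult_ac)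
  have "1 / b \<le> 1" using b by simp
  then have t1: "t \<le> 1" using t(2) by linarith
  define \<delta> where "\<delta> = 1 / real r + (1 - 1 / real r) * t"
  define F where "F = inf sequentially (principal {n. r dvd n})"
  define f where "f n = degree_threshold_at r t n / real n" for n
  \<comment> \<open>The additive error 1 in the threshold becomes \<open>1 / n\<close> after
    scaling.\<close>
  have bounds: "\<delta> - 1 / real n \<le> f n \<and> f n \<le> \<delta>" if n: "r dvd n" "n \<ge> 1" for n
  proof -
    obtain N where N: "n = r * N" using n(1) by (elim dvdE)
    have N1: "N \<ge> 1" and n0: "real n > 0" using n N by (auto simp: Suc_le_eq)
    have L: "\<delta> = (N + t * (real r * N - N)) / real n"
      using assms N1 by (simp add: \<delta>_def N field_simps)
    note deg = degree_threshold_at_bounds[OF assms N1 t(1) t1 small, folded N]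
    have "f n \<le> \<delta>" unfolding L f_def using deg(1) n0 by (intro divide_right_mono) auto
    moreover have "\<delta> - 1 / real n = (real N - 1 + t * (real r * N - N)) / real n"
      unfolding L by (simp add: diff_divide_distrib add_divide_distrib)
    then have "\<delta> - 1 / real n \<le> f n"
      unfolding f_def using deg(2) n0 by (simp add: divide_right_mono)
    ultimately show ?thesis by blast
  qed
  have ev: "eventually (\<lambda>n. \<delta> - 1 / real n \<le> f n \<and> f n \<le> \<delta>) F"
    unfolding F_def eventually_inf_principal
    using eventually_ge_at_top[of 1] by eventually_elim (use bounds in blast)
  have "((\<lambda>n. \<delta> - 1 / real n) \<longlongrightarrow> \<delta> - 0) F"
    unfolding F_def by (intro tendsto_mono[OF inf_le1] tendsto_diff tendsto_const lim_1_over_n)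
  then have "(f \<longlongrightarrow> \<delta>) F"
    using ev by (intro tendsto_sandwich[of "\<lambda>n. \<delta> - 1 / real n" f F "\<lambda>_. \<delta>"])
      (auto elim: eventually_mono)
  then have lim: "((\<lambda>n. ereal (f n)) \<longlongrightarrow> ereal \<delta>) F" by (rule tendsto_ereal)
  \<comment> \<open>There are arbitrarily large multiples of \<open>r\<close>, so the filter is
    proper and the limit determines \<open>Limsup\<close>.\<close>
  have "F \<noteq> bot"
  proof
    assume "F = bot"
    then have "eventually (\<lambda>_. False) F" by simp
    then obtain m where m: "\<And>n. n \<ge> m \<Longrightarrow> \<not> r dvd n"
      unfolding F_def eventually_inf_principal eventually_sequentially by auto
    have "m \<le> r * m" using assms by simp
    then show False using m[of "r * m"] by simp
  qed
  then show "degree_threshold r t = ereal (1 / real r + (1 - 1 / real r) * t)"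
    using lim_imp_Limsup[OF _ lim] by (simp add: degree_threshold_def F_def f_def \<delta>_def)
qed

end
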